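(* Let $\mathbb{J}_3$ be the compact topological group of $3$-adic integers. Let $\underline a=\{a_n\}_{n=0}^\infty$ be a (strictly) increasing sequence of non-negative integers, and put $y_n=3^{a_n}\in\mathbb{J}_3$ and $g_n=a_{n+1}-a_n$. The set $L_{\underline a,3}=\{0\}\cup\{\pm y_n\mid n\in\mathbb{N}\}$ is quasi-convex in $\mathbb{J}_3$ if and only if $g_n>1$ for all $n\in\mathbb{N}$.
   Context: $\mathbb{N}$ includes $0$. $\mathbb{T}=\mathbb{R}/\mathbb{Z}$ with canonical projection $\pi\colon\mathbb{R}\to\mathbb{T}$. Put $\mathbb{T}_+=\pi([-\frac14,\frac14])$. For an abelian topological group $G$, $\widehat G$ is the group of characters, i.e. continuous homomorphisms $G\to\mathbb{T}$. For $E\subseteq G$ and $A\subseteq\widehat G$ put $E^\triangleright=\{\chi\in\widehat G\mid\chi(E)\subseteq\mathbb{T}_+\}$ and $A^\triangleleft=\{x\in G\mid\chi(x)\in\mathbb{T}_+\text{ for all }\chi\in A\}$. The set $E$ is quasi-convex in $G$ if $E=E^{\triangleright\triangleleft}$; equivalently, for every $x\in G\setminus E$ there is $\chi\in E^\triangleright$ with $\chi(x)\notin\mathbb{T}_+$. *)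

theory Defs
  imports "HOL-Analysis.Analysis"
begin

text \<open>The group $\mathbb{R}/\mathbb{Z}$; the morphism \<open>circle_of\<close> is the canonical projection.\<close>

quotient_type circle = real / "\<lambda>x y. x - y \<in> \<int>"
  morphisms rep_circle circle_of
proof (rule equivpI)
  show "reflp (\<lambda>x y::real. x - y \<in> \<int>)"
    by (simp add: reflp_def)
  show "symp (\<lambda>x y::real. x - y \<in> \<int>)"
    by (rule sympI) (metis Ints_minus minus_diff_eq)
  show "transp (\<lambda>x y::real. x - y \<in> \<int>)"
  proof (rule transpI)
    fix x y z :: real
    assume "x - y \<in> \<int>" "y - z \<in> \<int>"
    then have "(x - y) + (y - z) \<in> \<int>" by (rule Ints_add)
    then show "x - z \<in> \<int>" by simp
  qed
qed

instantiation circle :: ab_group_add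
begin

lift_definition zero_circle :: circle is 0 .

lift_definition plus_circle :: "circle \<Rightarrow> circle \<Rightarrow> circle" is "(+)"
proof -
  fix a b c d :: real
  assume "a - b \<in> \<int>" "c - d \<in> \<int>"
  then have "(a - b) + (c - d) \<in> \<int>" by (rule Ints_add)
  then show "a + c - (b + d) \<in> \<int>" by (simp add: algebra_simps)
qed

lift_definition uminus_circle :: "circle \<Rightarrow> circle" is uminus
proof -
  fix a b :: real
  assume "a - b \<in> \<int>"
  then have "- (a - b) \<in> \<int>" by (rule Ints_minus)
  then show "- a - - b \<in> \<int>" by simp
qed

definition minus_circle :: "circle \<Rightarrow> circle \<Rightarrow> circle" where
  "minus_circle x y = x + - y"

instance
proof
  fix a b c :: circle
  show "a + b + c = a + (b + c)"
    by transfer (simp add: add.assoc)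
  show "a + b = b + a"
    by transfer (simp add: add.commute)
  show "0 + a = a"
    by transfer simp
  show "- a + a = 0"
    by transfer simp
  show "a - b = a + - b"
    by (rule minus_circle_def)
qed

end

instantiation circle :: topological_space
begin

definition open_circle :: "circle set \<Rightarrow> bool" where
  "open_circle U \<longleftrightarrow> open (circle_of -` U)"

instance
  by standard (auto simp: open_circle_def vimage_Union)

end

lemma circle_of_eq_iff: "circle_of x = circle_of y \<longleftrightarrow> x - y \<in> \<int>"
  by (rule circle.abs_eq_iff)

lemma circle_of_add: "circle_of (x + y) = circle_of x + circle_of y"
  by (simp add: plus_circle.abs_eq)

lemma circle_of_minus: "circle_of (- x) = - circle_of x"
  by (simp add: uminus_circle.abs_eq)

lemma circle_of_surj: "\<exists>r. x = circle_of r"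
  by (induct x rule: circle.abs_induct) blast

lemma continuous_on_circle_of: "continuous_on UNIV circle_of"
  by (simp add: continuous_on_open_vimage open_circle_def)

lemma open_circle_of_image:
  assumes "open A"
  shows "open (circle_of ` A)"
proof -
  have "circle_of -` (circle_of ` A) = (\<Union>k\<in>\<int>. (\<lambda>x. k + x) ` A)"
  proof (rule set_eqI)
    fix r
    have "r \<in> circle_of -` (circle_of ` A) \<longleftrightarrow> (\<exists>x\<in>A. r - x \<in> \<int>)"
      by (auto simp: circle_of_eq_iff image_iff)
    also have "\<dots> \<longleftrightarrow> r \<in> (\<Union>k\<in>\<int>. (\<lambda>x. k + x) ` A)"
    proof
      assume "\<exists>x\<in>A. r - x \<in> \<int>"
      then obtain x where x: "x \<in> A" "r - x \<in> \<int>" by blast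
      have "r = (r - x) + x" by simp
      with x show "r \<in> (\<Union>k\<in>\<int>. (\<lambda>x. k + x) ` A)" by blast
    next
      assume "r \<in> (\<Union>k\<in>\<int>. (\<lambda>x. k + x) ` A)"
      then obtain k x where "k \<in> \<int>" "x \<in> A" "r = k + x" by blast
      then show "\<exists>x\<in>A. r - x \<in> \<int>" by (intro bexI[of _ x]) simp_all
    qed
    finally show "r \<in> circle_of -` (circle_of ` A) \<longleftrightarrow> r \<in> (\<Union>k\<in>\<int>. (\<lambda>x. k + x) ` A)" .
  qed
  moreover have "open (\<Union>k\<in>\<int>. (\<lambda>x. k + x) ` A)"
    using assms by (intro open_UN ballI open_translation)
  ultimately show ?thesis by (simp add: open_circle_def)
qed

instance circle :: topological_ab_group_add
proof
  fix a b :: circle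
  obtain r s where rs: "a = circle_of r" "b = circle_of s"
    using circle_of_surj by metis
  show "LIM x (nhds a \<times>\<^sub>F nhds b). fst x + snd x :> nhds (a + b)"
  proof (rule topological_tendstoI)
    fix U :: "circle set" assume "open U" "a + b \<in> U"
    then have V: "open (circle_of -` U)" "r + s \<in> circle_of -` U"
      by (auto simp: open_circle_def rs circle_of_add)
    have "((\<lambda>x. fst x + snd x) \<longlongrightarrow> r + s) (nhds r \<times>\<^sub>F nhds s)"
      by (rule tendsto_add_Pair)
    from topological_tendstoD[OF this V]
    obtain P Q where PQ: "eventually P (nhds r)" "eventually Q (nhds s)"
      "\<And>x y. P x \<Longrightarrow> Q y \<Longrightarrow> x + y \<in> circle_of -` U"
      by (auto simp: eventually_prod_filter)
    obtain A where A: "open A" "r \<in> A" "\<And>x. x \<in> A \<Longrightarrow> P x"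
      using PQ(1) by (auto simp: eventually_nhds)
    obtain B where B: "open B" "s \<in> B" "\<And>x. x \<in> B \<Longrightarrow> Q x"
      using PQ(2) by (auto simp: eventually_nhds)
    have "eventually (\<lambda>x. x \<in> circle_of ` A) (nhds a)"
      using A open_circle_of_image by (auto simp: rs intro!: eventually_nhds_in_open)
    moreover have "eventually (\<lambda>x. x \<in> circle_of ` B) (nhds b)"
      using B open_circle_of_image by (auto simp: rs intro!: eventually_nhds_in_open)
    moreover have "x + y \<in> U" if "x \<in> circle_of ` A" "y \<in> circle_of ` B" for x y
      using that A(3) B(3) PQ(3) by (auto simp: circle_of_add)
    ultimately show "\<forall>\<^sub>F x in nhds a \<times>\<^sub>F nhds b. fst x + snd x \<in> U"
      unfolding eventually_prod_filter by fastforce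
  qed
next
  fix a :: circle
  show "(uminus \<longlongrightarrow> - a) (nhds a)"
  proof (rule topological_tendstoI)
    fix U :: "circle set" assume U: "open U" "- a \<in> U"
    have "circle_of -` (uminus -` U) = uminus -` (circle_of -` U)"
      by (auto simp: circle_of_minus)
    moreover have "open (uminus -` (circle_of -` U) :: real set)"
      using U(1) continuous_on_minus[OF continuous_on_id]
      unfolding open_circle_def by (rule open_vimage)
    ultimately have "open (uminus -` U)"
      by (simp add: open_circle_def)
    with U show "\<forall>\<^sub>F x in nhds a. - x \<in> U"
      by (auto simp: eventually_nhds)
  qed
qed

definition circle_plus :: "circle set" where
  "circle_plus = circle_of ` {-1/4..1/4}"

definition characters :: "('a::topological_ab_group_add \<Rightarrow> circle) set" where
  "characters = {\<phi>. continuous_on UNIV \<phi> \<and> (\<forall>x y. \<phi> (x + y) = \<phi> x + \<phi> y)}"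

definition polar :: "'a::topological_ab_group_add set \<Rightarrow> ('a \<Rightarrow> circle) set" where
  "polar E = {\<phi> \<in> characters. \<phi> ` E \<subseteq> circle_plus}"

definition prepolar :: "('a::topological_ab_group_add \<Rightarrow> circle) set \<Rightarrow> 'a set" where
  "prepolar A = {x. \<forall>\<phi>\<in>A. \<phi> x \<in> circle_plus}"

definition quasi_convex :: "'a::topological_ab_group_add set \<Rightarrow> bool" where
  "quasi_convex E \<longleftrightarrow> E = prepolar (polar E)"

text \<open>
  The 3-adic integers are the inverse limit of the rings $\mathbb{Z}/3^n\mathbb{Z}$, each
  residue class being represented by its least non-negative element.
\<close>

typedef padic3 = "{x :: nat \<Rightarrow> int. \<forall>n. 0 \<le> x n \<and> x n < 3 ^ n \<and> x (Suc n) mod 3 ^ n = x n}"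
  morphisms residue3 Abs_padic3
  by (rule exI[of _ "\<lambda>_. 0"]) simp

setup_lifting type_definition_padic3

lemma mod_Suc_power3 [simp]: "(x::int) mod 3 ^ Suc n mod 3 ^ n = x mod 3 ^ n"
  by (rule mod_mod_cancel) simp

instantiation padic3 :: comm_ring_1
begin

lift_definition zero_padic3 :: padic3 is "\<lambda>_. 0" by simp

lift_definition one_padic3 :: padic3 is "\<lambda>n. 1 mod 3 ^ n"
  by (simp del: power_Suc)

lift_definition plus_padic3 :: "padic3 \<Rightarrow> padic3 \<Rightarrow> padic3"
  is "\<lambda>x y n. (x n + y n) mod 3 ^ n"
  by (simp del: power_Suc) (metis mod_add_eq)

lift_definition uminus_padic3 :: "padic3 \<Rightarrow> padic3"
  is "\<lambda>x n. (- x n) mod 3 ^ n"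
  by (simp del: power_Suc) (metis mod_minus_eq)

lift_definition minus_padic3 :: "padic3 \<Rightarrow> padic3 \<Rightarrow> padic3"
  is "\<lambda>x y n. (x n - y n) mod 3 ^ n"
  by (simp del: power_Suc) (metis mod_diff_eq)

lift_definition times_padic3 :: "padic3 \<Rightarrow> padic3 \<Rightarrow> padic3"
  is "\<lambda>x y n. (x n * y n) mod 3 ^ n"
  by (simp del: power_Suc) (metis mod_mult_eq)

instance
proof
  fix a b c :: padic3
  show "a * b * c = a * (b * c)"
    by transfer (simp add: mod_mult_left_eq mod_mult_right_eq mult.assoc)
  show "a * b = b * a"
    by transfer (simp add: mult.commute)
  show "1 * a = a"
    by transfer (simp add: mod_mult_left_eq)
  show "a + b + c = a + (b + c)"
    by transfer (simp add: mod_add_left_eq mod_add_right_eq add.assoc)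
  show "a + b = b + a"
    by transfer (simp add: add.commute)
  show "0 + a = a"
    by transfer simp
  show "- a + a = 0"
    by transfer (simp add: mod_add_left_eq)
  show "a - b = a + - b"
    by transfer (simp add: mod_add_right_eq)
  show "(a + b) * c = a * c + b * c"
    by transfer (simp add: mod_mult_left_eq mod_add_eq distrib_right)
  show "(0::padic3) \<noteq> 1"
  proof (transfer, rule notI)
    assume "(\<lambda>_. 0) = (\<lambda>n. 1 mod 3 ^ n :: int)"
    from fun_cong[OF this, of 1] show False by simp
  qed
qed

end

text \<open>The topology is the one induced by the product of the discrete spaces.\<close>

instantiation padic3 :: topological_space
begin

definition open_padic3 :: "padic3 set \<Rightarrow> bool" where
  "open_padic3 U \<longleftrightarrow> (\<exists>V. open V \<and> U = residue3 -` V)"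

instance
proof
  show "open (UNIV :: padic3 set)"
    unfolding open_padic3_def by (rule exI[of _ UNIV]) simp
next
  fix S T :: "padic3 set"
  assume "open S" "open T"
  then show "open (S \<inter> T)"
    unfolding open_padic3_def by (metis open_Int vimage_Int)
next
  fix K :: "padic3 set set"
  assume "\<forall>S\<in>K. open S"
  then obtain f where f: "\<And>S. S \<in> K \<Longrightarrow> open (f S) \<and> S = residue3 -` f S"
    unfolding open_padic3_def by metis
  have "\<Union>K = residue3 -` (\<Union>S\<in>K. f S)"
    using f by blast
  moreover have "open (\<Union>S\<in>K. f S)"
    using f by blast
  ultimately show "open (\<Union>K)"
    unfolding open_padic3_def by blast
qed

end

lemma continuous_on_residue3: "continuous_on UNIV residue3"
  unfolding continuous_on_open_vimage[OF open_UNIV] by (auto simp: open_padic3_def)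

lemma open_residue3_eq: "open {x. residue3 x n = k}"
proof -
  have "open ((\<lambda>x. residue3 x n) -` {k})"
    using continuous_on_product_then_coordinatewise[OF continuous_on_residue3, of n]
    by (intro open_vimage) (auto simp: open_discrete)
  then show ?thesis by (simp add: vimage_def)
qed

lemma tendsto_padic3_iff:
  "(f \<longlongrightarrow> (l::padic3)) F \<longleftrightarrow> (\<forall>n. \<forall>\<^sub>F x in F. residue3 (f x) n = residue3 l n)"
proof (intro iffI allI)
  fix n
  assume "(f \<longlongrightarrow> l) F"
  from topological_tendstoD[OF this open_residue3_eq[of n "residue3 l n"]]
  show "\<forall>\<^sub>F x in F. residue3 (f x) n = residue3 l n" by simp
next
  assume *: "\<forall>n. \<forall>\<^sub>F x in F. residue3 (f x) n = residue3 l n"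
  show "(f \<longlongrightarrow> l) F"
  proof (rule topological_tendstoI)
    fix U :: "padic3 set" assume "open U" "l \<in> U"
    then obtain V where V: "open V" "U = residue3 -` V" "residue3 l \<in> V"
      by (auto simp: open_padic3_def)
    from V(1,3) obtain X where X: "finite {i. X i \<noteq> UNIV}" "residue3 l \<in> Pi UNIV X" "Pi UNIV X \<subseteq> V"
      unfolding open_fun_def openin_product_topology_alt by (fastforce simp: PiE_UNIV_domain)
    have "\<forall>\<^sub>F x in F. \<forall>i\<in>{i. X i \<noteq> UNIV}. residue3 (f x) i = residue3 l i"
      using * by (intro eventually_ball_finite X(1)) auto
    then show "\<forall>\<^sub>F x in F. f x \<in> U"
    proof eventually_elim
      case (elim x)
      have "residue3 (f x) i \<in> X i" for i
        using elim X(2) by (cases "X i = UNIV") auto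
      then show ?case using X(3) V(2) by auto
    qed
  qed
qed

instance padic3 :: topological_ab_group_add
proof
  fix a b :: padic3
  have id: "\<forall>\<^sub>F x in nhds c. residue3 x n = residue3 c n" for c n
    using open_residue3_eq by (auto intro!: eventually_nhds_in_open[of "{x. residue3 x n = residue3 c n}", simplified])
  show "LIM x (nhds a \<times>\<^sub>F nhds b). fst x + snd x :> nhds (a + b)"
    unfolding tendsto_padic3_iff
  proof
    fix n
    show "\<forall>\<^sub>F x in nhds a \<times>\<^sub>F nhds b. residue3 (fst x + snd x) n = residue3 (a + b) n"
      unfolding eventually_prod_filter
      using id[of n a] id[of n b] by (fastforce simp: plus_padic3.rep_eq)
  qed
  show "(uminus \<longlongrightarrow> - a) (nhds a)"
    unfolding tendsto_padic3_iff
  proof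
    fix n
    show "\<forall>\<^sub>F x in nhds a. residue3 (- x) n = residue3 (- a) n"
      using id[of n a] by eventually_elim (simp add: uminus_padic3.rep_eq)
  qed
qed

instance padic3 :: t2_space
proof
  fix x y :: padic3
  assume "x \<noteq> y"
  then obtain n where "residue3 x n \<noteq> residue3 y n"
    by (metis residue3_inject ext)
  then show "\<exists>U V. open U \<and> open V \<and> x \<in> U \<and> y \<in> V \<and> U \<inter> V = {}"
    using open_residue3_eq
    by (intro exI[of _ "{z. residue3 z n = residue3 x n}"]
        exI[of _ "{z. residue3 z n = residue3 y n}"]) auto
qed

lemma compact_UNIV_padic3: "compact (UNIV :: padic3 set)"
proof -
  let ?S = "{x :: nat \<Rightarrow> int. \<forall>n. 0 \<le> x n \<and> x n < 3 ^ n \<and> x (Suc n) mod 3 ^ n = x n}"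
  let ?P = "Pi UNIV (\<lambda>n. {0..<3 ^ n}) :: (nat \<Rightarrow> int) set"
  have "compactin (product_topology (\<lambda>i. euclidean) UNIV) (PiE UNIV (\<lambda>n. {0..<3 ^ n} :: int set))"
    by (auto simp: compactin_PiE intro!: finite_imp_compact)
  then have P: "compact ?P"
    by (simp add: euclidean_product_topology PiE_UNIV_domain)
  have "closed {x :: nat \<Rightarrow> int. x (Suc n) mod 3 ^ n = x n}" for n
  proof -
    have c: "continuous_on UNIV (\<lambda>x :: nat \<Rightarrow> int. x i)" for i
      by (rule continuous_on_product_coordinates)
    have "continuous_on UNIV (\<lambda>x :: nat \<Rightarrow> int. x (Suc n) mod 3 ^ n)"
      by (rule continuous_on_compose2[of UNIV "\<lambda>k. k mod 3 ^ n", OF _ c]) auto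
    then show ?thesis
      using c by (rule closed_Collect_eq)
  qed
  then have "closed (\<Inter>n. {x :: nat \<Rightarrow> int. x (Suc n) mod 3 ^ n = x n})"
    by blast
  with P have "compact (?P \<inter> (\<Inter>n. {x :: nat \<Rightarrow> int. x (Suc n) mod 3 ^ n = x n}))"
    by (rule compact_Int_closed)
  also have "?P \<inter> (\<Inter>n. {x :: nat \<Rightarrow> int. x (Suc n) mod 3 ^ n = x n}) = ?S"
    by (auto simp: Pi_iff)
  finally have S: "compact ?S" .
  show ?thesis
  proof (rule compactI)
    fix C :: "padic3 set set"
    assume C: "\<forall>t\<in>C. open t" "UNIV \<subseteq> \<Union>C"
    from C(1) obtain f where f: "\<And>U. U \<in> C \<Longrightarrow> open (f U) \<and> U = residue3 -` f U"
      unfolding open_padic3_def by metis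
    have "?S \<subseteq> (\<Union>U\<in>C. f U)"
    proof
      fix x assume "x \<in> ?S"
      then have x: "residue3 (Abs_padic3 x) = x" by (rule Abs_padic3_inverse)
      obtain U where "U \<in> C" "Abs_padic3 x \<in> U" using C(2) by blast
      with f x show "x \<in> (\<Union>U\<in>C. f U)" by (metis UN_iff vimageD)
    qed
    with S f obtain D where D: "D \<subseteq> C" "finite D" "?S \<subseteq> (\<Union>U\<in>D. f U)"
      by (metis (no_types, lifting) compactE_image)
    have "UNIV \<subseteq> \<Union>D"
    proof
      fix z :: padic3
      have "residue3 z \<in> ?S" by (rule residue3)
      with D(3) obtain U where "U \<in> D" "residue3 z \<in> f U" by blast
      with f D(1) show "z \<in> \<Union>D" by blast
    qed
    with D show "\<exists>D\<subseteq>C. finite D \<and> UNIV \<subseteq> \<Union>D" by blast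
  qed
qed

definition L_set :: "(nat \<Rightarrow> nat) \<Rightarrow> padic3 set" where
  "L_set a = {0} \<union> (\<Union>n. {3 ^ a n, - (3 ^ a n)})"

end

theory Submission
  imports Defs "HOL-Number_Theory.Cong"
begin

text \<open>
  Necessity: if \<open>3^k\<close> and \<open>3^(k+1)\<close> both lie in the set and a polar character sends \<open>3^k\<close> to the
  class of \<open>t\<close> with \<open>\<bar>t\<bar> \<le> 1/4\<close>, then \<open>\<bar>t\<bar> \<le> 1/12\<close> or \<open>\<bar>t\<bar> = 1/4\<close>; the latter is incompatible with
  continuity because \<open>3^j t\<close> would stay at \<open>\<plusminus>1/4\<close>. So \<open>2 * 3^k\<close> lies in the hull.

  Sufficiency: let \<open>x\<close> be in the hull. For \<open>k\<close> not among the exponents, the characters \<open>c / 3^(k+1)\<close>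
  with \<open>c = 1, 2\<close> are polar, so \<open>x\<close> is congruent mod \<open>3^(k+1)\<close> to an integer of size at most
  \<open>3^(k+1) / 8\<close>. Hence the nonzero digits of the balanced ternary expansion of \<open>x\<close> occur only at
  exponents of the sequence. If the first two are \<open>1\<close> at \<open>v\<close> and \<open>\<delta> = \<plusminus>1\<close> at \<open>w\<close>, the character
  \<open>(3^(w-v) + 2\<delta>) / 3^(w+2)\<close> is polar, but sends \<open>x\<close> to \<open>1/3 + 2\<delta> / 3^(w-v+2)\<close>, which is outside
  \<open>[-1/4, 1/4]\<close> modulo \<open>1\<close>.
\<close>

section \<open>Integers among the 3-adic integers\<close>

lemma residue3_of_nat: "residue3 (of_nat m) n = int m mod 3 ^ n"
  by (induction m)
    (simp_all add: zero_padic3.rep_eq plus_padic3.rep_eq one_padic3.rep_eq mod_add_eq)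

lemma residue3_of_int: "residue3 (of_int i) n = i mod 3 ^ n"
proof (cases "i \<ge> 0")
  case True
  then show ?thesis using residue3_of_nat[of "nat i" n] by simp
next
  case False
  then have "of_int i = (- of_nat (nat (- i)) :: padic3)" by simp
  then have "residue3 (of_int i) n = (- (int (nat (- i)) mod 3 ^ n)) mod 3 ^ n"
    by (simp only: uminus_padic3.rep_eq residue3_of_nat)
  also have "\<dots> = i mod 3 ^ n"
    using False by (simp add: mod_minus_eq)
  finally show ?thesis .
qed

lemma residue3_power3: "residue3 (3 ^ k) n = 3 ^ k mod 3 ^ n"
  using residue3_of_int[of "3 ^ k" n] by simp

lemma residue3_mod_power3: "m \<le> n \<Longrightarrow> residue3 x n mod 3 ^ m = residue3 x m"
proof (induction n rule: dec_induct)
  case base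
  then show ?case using residue3[of x] by simp
next
  case (step n)
  have "residue3 x (Suc n) mod 3 ^ n = residue3 x n" using residue3[of x] by blast
  moreover have "residue3 x (Suc n) mod 3 ^ n mod 3 ^ m = residue3 x (Suc n) mod 3 ^ m"
    using step.hyps by (intro mod_mod_cancel le_imp_power_dvd) simp
  ultimately show ?case using step.IH by simp
qed

text \<open>At level \<open>n = |i|\<close> a zero residue says that \<open>3 ^ n\<close> divides
  \<open>i\<close>, while \<open>3 ^ n\<close> exceeds \<open>|i|\<close>. Equations between
  integers inside \<open>padic3\<close> can thus be decided in \<open>int\<close>.\<close>

lemma of_int_padic3_eq_0_iff: "(of_int i :: padic3) = 0 \<longleftrightarrow> i = 0"
proof
  assume "(of_int i :: padic3) = 0"
  then have "3 ^ nat \<bar>i\<bar> dvd i"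
    using residue3_of_int[of i "nat \<bar>i\<bar>"] by (auto simp: zero_padic3.rep_eq)
  moreover have "int (nat \<bar>i\<bar>) < 2 ^ nat \<bar>i\<bar>" by (rule of_nat_less_two_power)
  moreover have "(2::int) ^ nat \<bar>i\<bar> \<le> 3 ^ nat \<bar>i\<bar>" by (rule power_mono) simp_all
  ultimately show "i = 0"
    using dvd_imp_le_int[of i "3 ^ nat \<bar>i\<bar>"] by auto
qed simp

lemma power3_tendsto_0: "(\<lambda>j. 3 ^ (k + j) :: padic3) \<longlonglongrightarrow> 0"
  unfolding tendsto_padic3_iff
proof
  fix n
  have "residue3 (3 ^ (k + j)) n = residue3 0 n" if "j \<ge> n" for j
  proof -
    have "(3::int) ^ n dvd 3 ^ (k + j)" using that by (intro le_imp_power_dvd) simp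
    then show ?thesis by (simp add: residue3_power3 zero_padic3.rep_eq)
  qed
  then show "\<forall>\<^sub>F j in sequentially. residue3 (3 ^ (k + j)) n = residue3 0 n"
    by (rule eventually_sequentiallyI)
qed

text \<open>\<open>v\<close> is the 3-adic valuation and \<open>\<delta>\<close> the lowest nonzero
  digit in balanced ternary: an ordinary digit 2 becomes -1 because
  \<open>2 * 3 ^ v = - 3 ^ v + 3 ^ Suc v\<close>.\<close>

lemma padic3_leading_digit:
  assumes "x \<noteq> 0"
  obtains v and \<delta> :: int
  where "\<delta> = 1 \<or> \<delta> = -1" "residue3 x v = 0" "[residue3 x (Suc v) = \<delta> * 3 ^ v] (mod 3 ^ Suc v)"
proof -
  define m where "m = (LEAST n. residue3 x n \<noteq> 0)"
  obtain n where "residue3 x n \<noteq> 0"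
    using assms by (metis residue3_inject ext zero_padic3.rep_eq)
  then have m: "residue3 x m \<noteq> 0" unfolding m_def by (rule LeastI)
  \<comment> \<open>Residues modulo \<open>3 ^ 0 = 1\<close> vanish, so the least index with a
    nonzero residue is a successor.\<close>
  have m0: "residue3 x 0 = 0" using residue3[of x] by (auto dest: spec[of _ 0])
  obtain v where v: "m = Suc v" using m m0 by (cases m) auto
  have z: "residue3 x v = 0"
    using not_less_Least[of v "\<lambda>n. residue3 x n \<noteq> 0"] v unfolding m_def by auto
  have "residue3 x (Suc v) mod 3 ^ v = 0"
    using residue3[of x] z by simp
  then obtain q where q: "residue3 x (Suc v) = 3 ^ v * q" by (auto simp: mod_eq_0_iff_dvd dvd_def)
  have "0 \<le> residue3 x (Suc v)" "residue3 x (Suc v) < 3 ^ Suc v" using residue3[of x] by blast+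
  then have "0 \<le> q" "q < 3" 
    using zero_le_mult_iff[of "3 ^ v" q] mult_less_cancel_left_pos[of "3 ^ v" q 3]
    by (auto simp: q mult.commute not_le[symmetric])
  moreover have "q \<noteq> 0" using q m v by auto
  ultimately consider "q = 1" | "q = 2" by linarith
  then show thesis
  proof cases
    case 1
    then show ?thesis using that[of 1 v] z q by simp
  next
    case 2
    then have "residue3 x (Suc v) = -1 * 3 ^ v + 3 ^ Suc v" using q by simp
    then have "[residue3 x (Suc v) = -1 * 3 ^ v] (mod 3 ^ Suc v)"
      by (simp only: cong_def mod_add_self2)
    then show ?thesis using that[of "-1" v] z by blast
  qed
qed

section \<open>Characters\<close>

lemma circle_of_0: "circle_of 0 = 0"
  by (simp add: zero_circle_def)

lemma circle_of_in_circle_plus_iff: "circle_of r \<in> circle_plus \<longleftrightarrow> (\<exists>k::int. \<bar>r - k\<bar> \<le> 1/4)"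
proof
  assume "circle_of r \<in> circle_plus"
  then obtain s where "s \<in> {-1/4..1/4}" "circle_of r = circle_of s"
    by (auto simp: circle_plus_def)
  then have s: "\<bar>s\<bar> \<le> 1/4" "r - s \<in> \<int>"
    by (auto simp: circle_of_eq_iff abs_le_iff)
  then obtain k :: int where "r - s = k" by (auto elim: Ints_cases)
  then have "\<bar>r - k\<bar> = \<bar>s\<bar>" by (simp add: algebra_simps)
  with s show "\<exists>k::int. \<bar>r - k\<bar> \<le> 1/4" by (intro exI[of _ k]) simp
next
  assume "\<exists>k::int. \<bar>r - k\<bar> \<le> 1/4"
  then obtain k :: int where k: "\<bar>r - k\<bar> \<le> 1/4" by blast
  have "circle_of r = circle_of (r - k)" by (simp add: circle_of_eq_iff)
  moreover have "r - k \<in> {-1/4..1/4}" using k by (auto simp: abs_if split: if_splits)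
  ultimately show "circle_of r \<in> circle_plus" by (simp add: circle_plus_def)
qed

lemma circle_plus_uminus: "- x \<in> circle_plus \<longleftrightarrow> x \<in> circle_plus"
proof -
  have "- y \<in> circle_plus" if y: "y \<in> circle_plus" for y
  proof -
    obtain s where s: "s \<in> {-1/4..1/4}" "y = circle_of s" using y by (auto simp: circle_plus_def)
    then have "- y = circle_of (- s)" "- s \<in> {-1/4..1/4}" by (auto simp: circle_of_minus)
    then show ?thesis unfolding circle_plus_def by blast
  qed
  from this[of x] this[of "- x"] show ?thesis by auto
qed

lemma character_0: "\<phi> \<in> characters \<Longrightarrow> \<phi> 0 = 0"
  unfolding characters_def by (metis (mono_tags, lifting) add_cancel_right_right mem_Collect_eq)

lemma character_uminus: "\<phi> \<in> characters \<Longrightarrow> \<phi> (- x) = - \<phi> x"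
proof -
  assume \<phi>: "\<phi> \<in> characters"
  have "\<phi> (- x + x) = \<phi> (- x) + \<phi> x" using \<phi> unfolding characters_def by blast
  then show ?thesis using character_0[OF \<phi>] by (simp add: eq_neg_iff_add_eq_0)
qed

lemma prepolar_uminus: "x \<in> prepolar (polar E) \<Longrightarrow> - x \<in> prepolar (polar E)"
  unfolding prepolar_def polar_def by (auto simp: character_uminus circle_plus_uminus)

lemma subset_prepolar_polar: "E \<subseteq> prepolar (polar E)"
  unfolding prepolar_def polar_def by auto

text \<open>This is the element c / 3^N of the Pruefer group, the Pontryagin dual of the 3-adic
  integers. The least residue can stand for \<open>x\<close>, since a change by a multiple of
  \<open>3 ^ N\<close> alters the quotient by an integer.\<close>

definition fraction_char :: "int \<Rightarrow> nat \<Rightarrow> padic3 \<Rightarrow> circle" where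
  "fraction_char c N x = circle_of (real_of_int (c * residue3 x N) / 3 ^ N)"

lemma circle_of_fraction_eq:
  assumes "[i = j] (mod 3 ^ N)"
  shows "circle_of (real_of_int i / 3 ^ N) = circle_of (real_of_int j / 3 ^ N)"
proof -
  obtain q where "i - j = 3 ^ N * q" using assms by (auto simp: cong_iff_dvd_diff dvd_def)
  then have "real_of_int i - real_of_int j = 3 ^ N * real_of_int q"
    by (metis of_int_diff of_int_mult of_int_numeral of_int_power)
  then have "real_of_int i / 3 ^ N - real_of_int j / 3 ^ N = real_of_int q"
    by (simp add: field_simps)
  then show ?thesis by (simp add: circle_of_eq_iff)
qed

text \<open>Continuity is local constancy: the value depends only on the residue modulo
  \<open>3 ^ N\<close>.\<close>

lemma fraction_char_character: "fraction_char c N \<in> characters"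
proof -
  have "continuous_on UNIV (fraction_char c N)"
    unfolding continuous_on_def
  proof
    fix x
    have "\<forall>\<^sub>F y in at x. residue3 y N = residue3 x N"
      using tendsto_padic3_iff[of "\<lambda>y. y" x "at x"] by simp
    then have "\<forall>\<^sub>F y in at x. fraction_char c N y = fraction_char c N x"
      by eventually_elim (simp add: fraction_char_def)
    then show "(fraction_char c N \<longlongrightarrow> fraction_char c N x) (at x within UNIV)"
      by (rule tendsto_eventually)
  qed
  moreover have "fraction_char c N (x + y) = fraction_char c N x + fraction_char c N y" for x y
  proof -
    have "[c * residue3 (x + y) N = c * residue3 x N + c * residue3 y N] (mod 3 ^ N)"
      by (simp add: plus_padic3.rep_eq cong_def mod_mult_right_eq distrib_left)
    from circle_of_fraction_eq[OF this] show ?thesis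
      by (simp add: fraction_char_def add_divide_distrib circle_of_add)
  qed
  ultimately show ?thesis by (simp add: characters_def)
qed

text \<open>Clearing the denominator \<open>3 ^ N\<close> turns closeness to an integer
  \<open>k\<close> into a bound on \<open>r = i - 3 ^ N * k\<close>, so that later estimates live in
  \<open>int\<close>.\<close>

lemma fraction_in_circle_plus_iff:
  "circle_of (real_of_int i / 3 ^ N) \<in> circle_plus \<longleftrightarrow>
    (\<exists>r. 4 * \<bar>r\<bar> \<le> 3 ^ N \<and> [i = r] (mod 3 ^ N))"
proof -
  have eq: "\<bar>real_of_int i / 3 ^ N - real_of_int k\<bar> \<le> 1/4 \<longleftrightarrow> 4 * \<bar>i - 3 ^ N * k\<bar> \<le> 3 ^ N" for k
  proof -
    have "real_of_int i / 3 ^ N - real_of_int k = real_of_int (i - 3 ^ N * k) / 3 ^ N"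
      by (simp add: field_simps)
    then have "\<bar>real_of_int i / 3 ^ N - real_of_int k\<bar> \<le> 1/4
        \<longleftrightarrow> real_of_int (4 * \<bar>i - 3 ^ N * k\<bar>) \<le> real_of_int (3 ^ N)"
      by (simp add: abs_divide field_simps)
    then show ?thesis by (simp only: of_int_le_iff)
  qed
  show ?thesis
    unfolding circle_of_in_circle_plus_iff eq
  proof
    assume "\<exists>k. 4 * \<bar>i - 3 ^ N * k\<bar> \<le> 3 ^ N"
    then obtain k where "4 * \<bar>i - 3 ^ N * k\<bar> \<le> 3 ^ N" by blast
    then show "\<exists>r. 4 * \<bar>r\<bar> \<le> 3 ^ N \<and> [i = r] (mod 3 ^ N)"
      by (intro exI[of _ "i - 3 ^ N * k"]) (simp add: cong_iff_dvd_diff)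
  next
    assume "\<exists>r. 4 * \<bar>r\<bar> \<le> 3 ^ N \<and> [i = r] (mod 3 ^ N)"
    then obtain r k where "4 * \<bar>r\<bar> \<le> 3 ^ N" "i - r = 3 ^ N * k"
      by (auto simp: cong_iff_dvd_diff dvd_def)
    moreover from this have "i - 3 ^ N * k = r" by simp
    ultimately show "\<exists>k. 4 * \<bar>i - 3 ^ N * k\<bar> \<le> 3 ^ N" by metis
  qed
qed

text \<open>The positive powers suffice: \<open>circle_plus\<close> contains 0 and is
  symmetric.\<close>

lemma fraction_char_polar:
  assumes "\<And>n. \<exists>r. 4 * \<bar>r\<bar> \<le> 3 ^ N \<and> [c * 3 ^ a n = r] (mod 3 ^ N)"
  shows "fraction_char c N \<in> polar (L_set a)"
proof -
  have "fraction_char c N (3 ^ a n) \<in> circle_plus" for n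
  proof -
    have "[c * residue3 (3 ^ a n) N = c * 3 ^ a n] (mod 3 ^ N)"
      by (simp add: residue3_power3 cong_def mod_mult_right_eq)
    then have "fraction_char c N (3 ^ a n) = circle_of (real_of_int (c * 3 ^ a n) / 3 ^ N)"
      unfolding fraction_char_def by (rule circle_of_fraction_eq)
    then show ?thesis using assms[of n] fraction_in_circle_plus_iff by presburger
  qed
  moreover have "0 \<in> circle_plus"
    using circle_of_in_circle_plus_iff[of 0] circle_of_0 by (auto intro: exI[of _ 0])
  ultimately show ?thesis
    unfolding polar_def L_set_def using fraction_char_character[of c N]
    by (auto simp: character_0 character_uminus circle_plus_uminus)
qed

text \<open>Every constraint on hull elements used for sufficiency is an instance of this for some
  \<open>c\<close> and \<open>N\<close>.\<close>

lemma hull_cong: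
  assumes "x \<in> prepolar (polar (L_set a))"
    and "\<And>n. \<exists>r. 4 * \<bar>r\<bar> \<le> 3 ^ N \<and> [c * 3 ^ a n = r] (mod 3 ^ N)"
  shows "\<exists>r. 4 * \<bar>r\<bar> \<le> 3 ^ N \<and> [c * residue3 x N = r] (mod 3 ^ N)"
proof -
  have "fraction_char c N x \<in> circle_plus"
    using assms(1) fraction_char_polar[of N c a, OF assms(2)] unfolding prepolar_def by blast
  then show ?thesis unfolding fraction_char_def fraction_in_circle_plus_iff .
qed

section \<open>Sufficiency\<close>

lemma cong_imp_eq_int:
  fixes i j m :: int
  assumes "[i = j] (mod m)" "\<bar>i - j\<bar> < m"
  shows "i = j"
proof (rule ccontr)
  assume "i \<noteq> j"
  then have "\<bar>m\<bar> \<le> \<bar>i - j\<bar>"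
    using assms(1) by (intro dvd_imp_le_int) (simp_all add: cong_iff_dvd_diff)
  then show False using assms(2) by linarith
qed

text \<open>With \<open>c = 1\<close> the residue has a representative \<open>r\<close> of size at
  most 1/4 of the modulus; with \<open>c = 2\<close> so does its double, say \<open>s\<close>. Then
  \<open>2 * r\<close> and \<open>s\<close> are congruent and differ by at most 3/4 of the modulus,
  so they are equal and the bound on \<open>r\<close> is halved.\<close>

lemma hull_cong_off_exponents:
  assumes x: "x \<in> prepolar (polar (L_set a))" and k: "k \<notin> range a"
  obtains r where "8 * \<bar>r\<bar> \<le> 3 ^ Suc k" "[residue3 x (Suc k) = r] (mod 3 ^ Suc k)"
proof -
  \<comment> \<open>Exponents below \<open>k\<close> give at most 2/9 of the modulus, which is below
    1/4; exponents above \<open>k\<close> give 0. At \<open>k\<close> itself the value would be 1/3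
    or 2/3.\<close>
  have small: "\<exists>r. 4 * \<bar>r\<bar> \<le> 3 ^ Suc k \<and> [c * 3 ^ a n = r] (mod 3 ^ Suc k)"
    if c: "c = 1 \<or> c = 2" for n and c :: int
  proof (cases "a n < k")
    case True
    then have "(3::int) ^ (a n + 2) \<le> 3 ^ Suc k" by (intro power_increasing) auto
    then have "9 * (3::int) ^ a n \<le> 3 ^ Suc k" by (simp add: power_add)
    moreover have "\<bar>c * 3 ^ a n\<bar> \<le> 2 * 3 ^ a n" using c by auto
    moreover have "(0::int) < 3 ^ a n" by simp
    ultimately have "4 * \<bar>c * 3 ^ a n\<bar> \<le> 3 ^ Suc k" by linarith
    then show ?thesis by (intro exI[of _ "c * 3 ^ a n"]) simp
  next
    case False
    then have "Suc k \<le> a n" using k by (metis nat_neq_iff rangeI Suc_leI)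
    then have "3 ^ Suc k dvd c * 3 ^ a n" by (intro dvd_mult le_imp_power_dvd)
    then show ?thesis by (intro exI[of _ 0]) (simp add: cong_0_iff)
  qed
  obtain r where r: "4 * \<bar>r\<bar> \<le> 3 ^ Suc k" "[residue3 x (Suc k) = r] (mod 3 ^ Suc k)"
    using hull_cong[of x a "Suc k" 1] x small[of 1] by auto
  obtain s where s: "4 * \<bar>s\<bar> \<le> 3 ^ Suc k" "[2 * residue3 x (Suc k) = s] (mod 3 ^ Suc k)"
    using hull_cong[of x a "Suc k" 2] x small[of 2] by auto
  have "[2 * residue3 x (Suc k) = 2 * r] (mod 3 ^ Suc k)" by (intro cong_mult cong_refl r(2))
  then have "[2 * r = s] (mod 3 ^ Suc k)" using s(2) by (meson cong_sym cong_trans)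
  moreover have "(0::int) < 3 ^ Suc k" by simp
  then have "\<bar>2 * r - s\<bar> < 3 ^ Suc k" using r(1) s(1) by linarith
  ultimately have "2 * r = s" by (rule cong_imp_eq_int)
  then show thesis using that[of r] r s by auto
qed

text \<open>Only the case of leading digit 1 is treated; the other one follows by passing to \<open>- x\<close>.\<close>

lemma hull_leading_digit_one:
  assumes a: "strict_mono a" and gap: "\<And>n. a (Suc n) - a n > 1"
    and x: "x \<in> prepolar (polar (L_set a))"
    and v: "residue3 x v = 0" and lead: "[residue3 x (Suc v) = 3 ^ v] (mod 3 ^ Suc v)"
  shows "x \<in> L_set a"
proof -
  have sep: "a i + 2 \<le> a j" if "a i < a j" for i j
  proof -
    have "Suc i \<le> j" using that a by (simp add: strict_mono_less)
    then have "a (Suc i) \<le> a j" using a by (simp add: strict_mono_less_eq)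
    then show ?thesis using gap[of i] by linarith
  qed
  \<comment> \<open>Otherwise the small representative would be \<open>3 ^ v\<close>, which is 1/3
    of the modulus and violates the bound 1/8.\<close>
  have "v \<in> range a"
  proof (rule ccontr)
    assume "v \<notin> range a"
    then obtain r where r: "8 * \<bar>r\<bar> \<le> 3 ^ Suc v" "[residue3 x (Suc v) = r] (mod 3 ^ Suc v)"
      by (rule hull_cong_off_exponents[OF x])
    have p: "(0::int) < 3 ^ v" by simp
    have "[r = 3 ^ v] (mod 3 ^ Suc v)" using r(2) lead by (meson cong_sym cong_trans)
    moreover have "\<bar>r - 3 ^ v\<bar> < 3 ^ Suc v" using r(1) p unfolding power_Suc by linarith
    ultimately have "r = 3 ^ v" by (rule cong_imp_eq_int)
    with r(1) p show False unfolding power_Suc by linarith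
  qed
  then obtain n where n: "v = a n" by blast
  \<comment> \<open>If not, the leading digit of \<open>x - 3 ^ v\<close> is the second nonzero
    balanced digit of \<open>x\<close>.\<close>
  have "x = 3 ^ v"
  proof (rule ccontr)
    assume "x \<noteq> 3 ^ v"
    then have "x - 3 ^ v \<noteq> 0" by simp
    then obtain w and \<delta> :: int where \<delta>: "\<delta> = 1 \<or> \<delta> = -1"
      and w: "residue3 (x - 3 ^ v) w = 0"
        "[residue3 (x - 3 ^ v) (Suc w) = \<delta> * 3 ^ w] (mod 3 ^ Suc w)"
      by (rule padic3_leading_digit)
    have x_w: "[residue3 x (Suc w) = 3 ^ v + \<delta> * 3 ^ w] (mod 3 ^ Suc w)"
    proof -
      have "residue3 (x - 3 ^ v) (Suc w) = (residue3 x (Suc w) - 3 ^ v mod 3 ^ Suc w) mod 3 ^ Suc w"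
        by (simp only: minus_padic3.rep_eq residue3_power3)
      then have "[residue3 x (Suc w) - 3 ^ v = \<delta> * 3 ^ w] (mod 3 ^ Suc w)"
        using w(2) unfolding cong_def by (simp only: mod_mod_trivial mod_diff_right_eq)
      then show ?thesis unfolding cong_iff_dvd_diff by (simp add: algebra_simps)
    qed
    have "w > v"
    proof (rule ccontr)
      assume "\<not> w > v"
      then have "residue3 (x - 3 ^ v) (Suc v) mod 3 ^ Suc w = residue3 (x - 3 ^ v) (Suc w)"
        by (intro residue3_mod_power3) simp
      moreover have "residue3 (x - 3 ^ v) (Suc v) = 0"
        using lead by (simp only: minus_padic3.rep_eq residue3_power3 cong_def)
          (metis diff_self mod_0 mod_diff_left_eq mod_diff_right_eq)
      ultimately have "3 ^ Suc w dvd \<delta> * 3 ^ w"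
        using w(2) by (metis cong_0_iff cong_sym mod_0)
      then show False using \<delta> by auto
    qed
    then have "(3::int) ^ Suc v \<le> 3 ^ w" by (intro power_increasing) auto
    then have vw: "3 * (3::int) ^ v \<le> 3 ^ w" by simp
    have p: "(0::int) < 3 ^ v" by simp
    have \<delta>abs: "\<bar>3 ^ v + \<delta> * 3 ^ w\<bar> \<le> 3 ^ v + 3 ^ w" "\<bar>3 ^ v + \<delta> * 3 ^ w\<bar> \<ge> 3 ^ w - 3 ^ v"
    proof -
      have "3 ^ v + \<delta> * 3 ^ w = 3 ^ v + 3 ^ w \<or> 3 ^ v + \<delta> * 3 ^ w = 3 ^ v - 3 ^ w"
        using \<delta> by auto
      then show "\<bar>3 ^ v + \<delta> * 3 ^ w\<bar> \<le> 3 ^ v + 3 ^ w" "\<bar>3 ^ v + \<delta> * 3 ^ w\<bar> \<ge> 3 ^ w - 3 ^ v"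
        using p vw by linarith+
    qed
    have \<delta>v: "\<bar>2 * \<delta> * 3 ^ v\<bar> = 2 * 3 ^ v" using \<delta> by auto
    \<comment> \<open>Same argument: \<open>3 ^ v + \<delta> * 3 ^ w\<close> has size at least 2/9
      of \<open>3 ^ Suc w\<close>, more than 1/8.\<close>
    have "w \<in> range a"
    proof (rule ccontr)
      assume "w \<notin> range a"
      then obtain r where r: "8 * \<bar>r\<bar> \<le> 3 ^ Suc w" "[residue3 x (Suc w) = r] (mod 3 ^ Suc w)"
        by (rule hull_cong_off_exponents[OF x])
      have "[r = 3 ^ v + \<delta> * 3 ^ w] (mod 3 ^ Suc w)" using r(2) x_w by (meson cong_sym cong_trans)
      moreover have "\<bar>r - (3 ^ v + \<delta> * 3 ^ w)\<bar> < 3 ^ Suc w"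
        using r(1) p vw \<delta>abs unfolding power_Suc by linarith
      ultimately have "r = 3 ^ v + \<delta> * 3 ^ w" by (rule cong_imp_eq_int)
      with r(1) p vw \<delta>abs show False unfolding power_Suc by linarith
    qed
    then obtain m where m: "w = a m" by blast
    have d: "v + 2 \<le> w" using sep[of n m] \<open>w > v\<close> n m by simp
    then have "(3::int) ^ (v + 2) \<le> 3 ^ w" by (intro power_increasing) auto
    then have vw9: "9 * (3::int) ^ v \<le> 3 ^ w" by (simp add: power_add)
    \<comment> \<open>The gap after \<open>w\<close> makes the digit at \<open>Suc w\<close> vanish,
      so \<open>x\<close> becomes known modulo \<open>3 ^ (w + 2)\<close>.\<close>
    have "Suc w \<notin> range a"
    proof
      assume "Suc w \<in> range a"
      then obtain l where "a l = Suc w" by (metis imageE)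
      then show False using sep[of m l] m by simp
    qed
    then obtain r where r: "8 * \<bar>r\<bar> \<le> 3 ^ Suc (Suc w)"
        "[residue3 x (Suc (Suc w)) = r] (mod 3 ^ Suc (Suc w))"
      by (rule hull_cong_off_exponents[OF x])
    \<comment> \<open>The bound on \<open>r\<close> is 9/8 of \<open>3 ^ w\<close>, small enough to
      identify \<open>r\<close> already modulo \<open>3 ^ Suc w\<close>.\<close>
    have "[residue3 x (Suc w) = r] (mod 3 ^ Suc w)"
    proof -
      have "[residue3 x (Suc (Suc w)) = r] (mod 3 ^ Suc w)"
        using r(2) by (rule cong_dvd_modulus) (intro le_imp_power_dvd, simp)
      then show ?thesis
        using residue3_mod_power3[of "Suc w" "Suc (Suc w)" x] unfolding cong_def
        by (metis mod_mod_trivial le_Suc_eq order_refl)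
    qed
    then have "[r = 3 ^ v + \<delta> * 3 ^ w] (mod 3 ^ Suc w)" using x_w by (meson cong_sym cong_trans)
    moreover have "\<bar>r - (3 ^ v + \<delta> * 3 ^ w)\<bar> < 3 ^ Suc w"
      using r(1) p vw \<delta>abs unfolding power_Suc by linarith
    ultimately have "r = 3 ^ v + \<delta> * 3 ^ w" by (rule cong_imp_eq_int)
    with r(2) have x_w2: "[residue3 x (w + 2) = 3 ^ v + \<delta> * 3 ^ w] (mod 3 ^ (w + 2))" by simp
    \<comment> \<open>The summand \<open>3 ^ (w - v)\<close> moves the digit 1 from \<open>v\<close>
      to \<open>w\<close>, and \<open>2 * \<delta>\<close> turns the digit \<open>\<delta>\<close>
      at \<open>w\<close> into 2 whatever its sign. They add up to \<open>3 * 3 ^ w\<close>, which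
      is 1/3 of the modulus; the other cross term vanishes since
      \<open>w - v \<ge> 2\<close>.\<close>
    define c :: int where "c = 3 ^ (w - v) + 2 * \<delta>"
    \<comment> \<open>Powers beyond \<open>w\<close> start at \<open>w + 2\<close> and vanish.
      Between \<open>v\<close> and \<open>w\<close> they start at \<open>v + 2\<close>, so only the
      part \<open>2 * \<delta>\<close> survives, at most 2/9 of the modulus. Up to \<open>v\<close>
      the size is at most \<open>3 ^ w + 2 * 3 ^ v\<close>, that is 11/81 of it.\<close>
    have polar: "\<exists>r. 4 * \<bar>r\<bar> \<le> 3 ^ (w + 2) \<and> [c * 3 ^ a l = r] (mod 3 ^ (w + 2))" for l
    proof -
      consider "a l > w" | "v < a l" "a l \<le> w" | "a l \<le> v" by linarith
      then show ?thesis
      proof cases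
        case 1
        then have "w + 2 \<le> a l" using sep m by auto
        then have "3 ^ (w + 2) dvd c * 3 ^ a l" by (intro dvd_mult le_imp_power_dvd)
        then show ?thesis by (intro exI[of _ 0]) (simp add: cong_0_iff)
      next
        case 2
        then have "v + 2 \<le> a l" using sep n by auto
        then have "(3::int) ^ (w + 2) dvd 3 ^ (w - v + a l)"
          using d by (intro le_imp_power_dvd) simp
        moreover have "c * 3 ^ a l - 2 * \<delta> * 3 ^ a l = 3 ^ (w - v + a l)"
          by (simp add: c_def power_add algebra_simps)
        ultimately have c: "[c * 3 ^ a l = 2 * \<delta> * 3 ^ a l] (mod 3 ^ (w + 2))"
          by (simp only: cong_iff_dvd_diff)
        have "(3::int) ^ a l \<le> 3 ^ w" using 2 by (intro power_increasing) auto
        moreover have "\<bar>2 * \<delta> * 3 ^ a l\<bar> = 2 * 3 ^ a l" using \<delta> by auto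
        moreover have "(3::int) ^ (w + 2) = 9 * 3 ^ w" "(0::int) < 3 ^ w" by (simp_all add: power_add)
        ultimately have "4 * \<bar>2 * \<delta> * 3 ^ a l\<bar> \<le> 3 ^ (w + 2)" by linarith
        with c show ?thesis by blast
      next
        case 3
        have cv: "c * 3 ^ v = 3 ^ w + 2 * \<delta> * 3 ^ v"
          using d by (simp add: c_def distrib_right flip: power_add)
        have "\<bar>c * 3 ^ a l\<bar> \<le> \<bar>c * 3 ^ v\<bar>"
          unfolding abs_mult using 3 by (intro mult_left_mono) (auto intro: power_increasing)
        moreover have "\<bar>c * 3 ^ v\<bar> \<le> 3 ^ w + 2 * 3 ^ v" using cv \<delta>v p vw by linarith
        moreover have "(3::int) ^ (w + 2) = 9 * 3 ^ w" by (simp add: power_add)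
        ultimately have "4 * \<bar>c * 3 ^ a l\<bar> \<le> 3 ^ (w + 2)" using vw9 p by linarith
        then show ?thesis by (intro exI[of _ "c * 3 ^ a l"]) simp
      qed
    qed
    obtain s where s: "4 * \<bar>s\<bar> \<le> 3 ^ (w + 2)" "[c * residue3 x (w + 2) = s] (mod 3 ^ (w + 2))"
      using hull_cong[of x a "w + 2" c] x polar by blast
    have "[c * residue3 x (w + 2) = c * (3 ^ v + \<delta> * 3 ^ w)] (mod 3 ^ (w + 2))"
      by (intro cong_mult cong_refl x_w2)
    moreover have "[c * (3 ^ v + \<delta> * 3 ^ w) = 3 * 3 ^ w + 2 * \<delta> * 3 ^ v] (mod 3 ^ (w + 2))"
    proof -
      have "3 ^ (w - v) * (3 ^ v :: int) = 3 ^ w" using d by (simp flip: power_add)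
      moreover have "\<delta> * \<delta> = 1" using \<delta> by auto
      moreover have "c * (3 ^ v + \<delta> * 3 ^ w) - (3 * 3 ^ w + 2 * \<delta> * 3 ^ v)
          = 3 ^ (w - v) * 3 ^ v + \<delta> * (3 ^ (w - v) * 3 ^ w) + 2 * (\<delta> * \<delta>) * 3 ^ w - 3 * 3 ^ w"
        by (simp add: c_def algebra_simps)
      ultimately have "c * (3 ^ v + \<delta> * 3 ^ w) - (3 * 3 ^ w + 2 * \<delta> * 3 ^ v) = \<delta> * 3 ^ (w - v + w)"
        by (simp add: power_add)
      moreover have "(3::int) ^ (w + 2) dvd 3 ^ (w - v + w)"
        using d by (intro le_imp_power_dvd) simp
      ultimately show ?thesis unfolding cong_iff_dvd_diff by simp
    qed
    ultimately have sc: "[s = 3 * 3 ^ w + 2 * \<delta> * 3 ^ v] (mod 3 ^ (w + 2))"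
      using s(2) by (meson cong_sym cong_trans)
    have N: "(3::int) ^ (w + 2) = 9 * 3 ^ w" by (simp add: power_add)
    have "\<bar>s - (3 * 3 ^ w + 2 * \<delta> * 3 ^ v)\<bar> < 3 ^ (w + 2)"
      using s(1) N vw9 p \<delta>v by linarith
    with sc have "s = 3 * 3 ^ w + 2 * \<delta> * 3 ^ v" by (rule cong_imp_eq_int)
    \<comment> \<open>By \<open>vw9\<close>, \<open>|s|\<close> is at least 25/9 of
      \<open>3 ^ w\<close>, but only 9/4 is allowed.\<close>
    then show False using s(1) N vw9 p \<delta>v by linarith
  qed
  then show ?thesis using n by (auto simp: L_set_def)
qed

lemma L_set_uminus: "- x \<in> L_set a \<longleftrightarrow> x \<in> L_set a"
  by (auto simp: L_set_def minus_equation_iff[of x])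

lemma hull_subset_L_set:
  assumes "strict_mono a" and "\<And>n. a (Suc n) - a n > 1"
  shows "prepolar (polar (L_set a)) \<subseteq> L_set a"
proof
  fix x assume x: "x \<in> prepolar (polar (L_set a))"
  show "x \<in> L_set a"
  proof (cases "x = 0")
    case True
    then show ?thesis by (simp add: L_set_def)
  next
    case False
    then obtain v and \<delta> :: int where \<delta>: "\<delta> = 1 \<or> \<delta> = -1" and v: "residue3 x v = 0"
      "[residue3 x (Suc v) = \<delta> * 3 ^ v] (mod 3 ^ Suc v)"
      by (rule padic3_leading_digit)
    from \<delta> show ?thesis
    proof
      assume "\<delta> = 1"
      then show ?thesis using hull_leading_digit_one[OF assms x v(1)] v(2) by simp
    next
      assume "\<delta> = -1"
      then have "[- residue3 x (Suc v) = 3 ^ v] (mod 3 ^ Suc v)"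
        using cong_minus_minus_iff[of "residue3 x (Suc v)" "- (3 ^ v)"] v(2) by simp
      then have "[residue3 (- x) (Suc v) = 3 ^ v] (mod 3 ^ Suc v)"
        by (simp add: uminus_padic3.rep_eq cong_def del: power_Suc)
      moreover have "residue3 (- x) v = 0" by (simp add: uminus_padic3.rep_eq v(1))
      ultimately have "- x \<in> L_set a"
        using hull_leading_digit_one[OF assms prepolar_uminus[OF x]] by blast
      then show ?thesis by (simp add: L_set_uminus)
    qed
  qed
qed

section \<open>Necessity\<close>

text \<open>In \<open>int\<close>, \<open>2 * 3 ^ k\<close> is positive and even, while powers of 3
  are odd.\<close>

lemma double_power3_notin_L_set: "3 ^ k + 3 ^ k \<notin> L_set a"
proof
  assume "3 ^ k + 3 ^ k \<in> L_set a"
  then consider "(3 ^ k + 3 ^ k :: padic3) = 0" | m where "(3 ^ k + 3 ^ k :: padic3) = 3 ^ m"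
    | m where "(3 ^ k + 3 ^ k :: padic3) = - (3 ^ m)"
    by (auto simp: L_set_def)
  then show False
  proof cases
    case 1
    then show False using of_int_padic3_eq_0_iff[of "3 ^ k + 3 ^ k"] by simp
  next
    case 2
    then have "2 * 3 ^ k - 3 ^ m = (0::int)"
      using of_int_padic3_eq_0_iff[of "3 ^ k + 3 ^ k - 3 ^ m"] by simp
    then have "even ((3::int) ^ m)" by (metis dvd_triv_left eq_iff_diff_eq_0)
    then show False by simp
  next
    case 3
    then have "3 ^ k + 3 ^ k + 3 ^ m = (0::int)"
      using of_int_padic3_eq_0_iff[of "3 ^ k + 3 ^ k + 3 ^ m"] by simp
    moreover have "(0::int) < 3 ^ k" "(0::int) < 3 ^ m" by simp_all
    ultimately show False by linarith
  qed
qed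

lemma character_power3:
  fixes \<phi> :: "padic3 \<Rightarrow> circle"
  assumes \<phi>: "\<phi> \<in> characters" and t: "\<phi> (3 ^ k) = circle_of t"
  shows "\<phi> (3 ^ (k + j)) = circle_of (3 ^ j * t)"
proof (induction j)
  case 0
  then show ?case using t by simp
next
  case (Suc j)
  have "(3::padic3) ^ (k + Suc j) = 3 ^ (k + j) + (3 ^ (k + j) + 3 ^ (k + j))" by simp
  then have "\<phi> (3 ^ (k + Suc j)) = \<phi> (3 ^ (k + j)) + (\<phi> (3 ^ (k + j)) + \<phi> (3 ^ (k + j)))"
    using \<phi> by (simp only: characters_def mem_Collect_eq)
  also have "\<dots> = circle_of (3 ^ Suc j * t)"
    unfolding Suc.IH circle_of_add[symmetric] by (simp add: algebra_simps)
  finally show ?case .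
qed

text \<open>As \<open>3 ^ (k + j)\<close> tends to 0, continuity brings the classes of
  \<open>3 ^ j * t\<close> into the open arc of radius 1/4 around 0. For \<open>t\<close> equal to
  1/4 or -1/4 they stay on its boundary.\<close>

lemma character_power3_not_quarter:
  fixes \<phi> :: "padic3 \<Rightarrow> circle"
  assumes \<phi>: "\<phi> \<in> characters" and t: "\<phi> (3 ^ k) = circle_of t"
  shows "\<bar>t\<bar> \<noteq> 1/4"
proof
  assume "\<bar>t\<bar> = 1/4"
  then obtain e :: int where e: "t = e / 4" "odd e"
    using that[of 1] that[of "-1"] by (cases "t \<ge> 0") auto
  let ?U = "circle_of ` {-1/4<..<1/4}"
  have "open ?U" by (intro open_circle_of_image) simp
  moreover have "\<phi> 0 \<in> ?U" using character_0[OF \<phi>] circle_of_0 by (intro image_eqI[of _ _ 0]) auto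
  moreover have "isCont \<phi> 0"
    using \<phi> by (simp add: characters_def continuous_on_eq_continuous_at)
  then have "(\<lambda>j. \<phi> (3 ^ (k + j))) \<longlonglongrightarrow> \<phi> 0"
    using power3_tendsto_0 by (rule isCont_tendsto_compose)
  ultimately have "\<forall>\<^sub>F j in sequentially. \<phi> (3 ^ (k + j)) \<in> ?U" by (intro topological_tendstoD)
  then obtain j where "\<phi> (3 ^ (k + j)) \<in> ?U"
    unfolding eventually_sequentially by blast
  then obtain s where "s \<in> {-1/4<..<1/4}" "circle_of (3 ^ j * t) = circle_of s"
    unfolding character_power3[OF \<phi> t] by blast
  then have s: "\<bar>s\<bar> < 1/4" "3 ^ j * t - s \<in> \<int>"
    by (auto simp: circle_of_eq_iff abs_if)
  then obtain q :: int where "3 ^ j * t - s = q" by (auto elim: Ints_cases)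
  \<comment> \<open>\<open>4 * s\<close> is an integer of absolute value below 1, hence 0, which
    makes the odd number \<open>3 ^ j * e\<close> even.\<close>
  then have "4 * s = real_of_int (3 ^ j * e - 4 * q)" using e by simp
  moreover from this have "\<bar>real_of_int (3 ^ j * e - 4 * q)\<bar> < 1" using s by linarith
  ultimately have "3 ^ j * e - 4 * q = 0" by linarith
  then have "3 ^ j * e = 2 * (2 * q)" by simp
  then have "even (3 ^ j * e)" by (metis dvd_triv_left)
  then show False using e by simp
qed

lemma consecutive_exponents_not_quasi_convex:
  assumes "a (Suc n) = Suc (a n)"
  shows "\<not> quasi_convex (L_set a)"
proof -
  let ?y = "3 ^ a n :: padic3"
  have "?y + ?y \<in> prepolar (polar (L_set a))"
    unfolding prepolar_def
  proof (intro CollectI ballI)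
    fix \<phi> assume p: "\<phi> \<in> polar (L_set a)"
    then have \<phi>: "\<phi> \<in> characters" by (simp add: polar_def)
    have L: "\<phi> (3 ^ a i) \<in> circle_plus" for i
      using p by (auto simp: polar_def L_set_def image_subset_iff)
    obtain t where t: "\<phi> ?y = circle_of t" and "t \<in> {-1/4..1/4}"
      using L[of n] unfolding circle_plus_def by blast
    then have t_le: "\<bar>t\<bar> \<le> 1/4" by (auto simp: abs_if)
    have "circle_of (3 * t) \<in> circle_plus"
      using L[of "Suc n"] character_power3[OF \<phi> t, of 1] assms by simp
    then obtain k :: int where k: "\<bar>3 * t - k\<bar> \<le> 1/4" by (auto simp: circle_of_in_circle_plus_iff)
    have nq: "\<bar>t\<bar> < 1/4" using t_le character_power3_not_quarter[OF \<phi> t] by simp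
    \<comment> \<open>Here \<open>|k| \<le> 3 * |t| + 1/4\<close>, and the strict bound on
      \<open>|t|\<close> excludes \<open>k = 1\<close> and \<open>k = -1\<close>. Then
      \<open>|t| \<le> 1/12\<close>, so doubling stays within 1/6.\<close>
    have "\<bar>real_of_int k\<bar> < 1" using k nq by linarith
    then have "k = 0" by linarith
    then have "\<bar>t + t\<bar> \<le> 1/4" using k by simp
    then have "circle_of (t + t) \<in> circle_plus"
      unfolding circle_of_in_circle_plus_iff by (intro exI[of _ 0]) simp
    moreover have "\<phi> (?y + ?y) = circle_of (t + t)"
      using \<phi> t by (simp only: characters_def circle_of_add mem_Collect_eq)
    ultimately show "\<phi> (?y + ?y) \<in> circle_plus" by simp
  qed
  then show ?thesis using double_power3_notin_L_set unfolding quasi_convex_def by blast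
qed

theorem theorem4:
  fixes a :: "nat \<Rightarrow> nat"
  assumes "strict_mono a"
  shows "quasi_convex (L_set a) \<longleftrightarrow> (\<forall>n. a (Suc n) - a n > 1)"
proof
  assume q: "quasi_convex (L_set a)"
  show "\<forall>n. a (Suc n) - a n > 1"
  proof
    fix n
    have "a n < a (Suc n)" using assms by (simp add: strict_mono_Suc_iff)
    moreover have "a (Suc n) \<noteq> Suc (a n)" using q consecutive_exponents_not_quasi_convex by blast
    ultimately show "a (Suc n) - a n > 1" by linarith
  qed
next
  assume "\<forall>n. a (Suc n) - a n > 1"
  then show "quasi_convex (L_set a)"
    unfolding quasi_convex_def
    using hull_subset_L_set[OF assms] subset_prepolar_polar by blast
qed

end
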